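(* Let $G=(V,E)$ be a graph, $X,Y\subseteq V$ and $k\in\mathbb{N}$, $k\geq 1$. The number of leftmost $(X,Y,\leq k)^G$-separators is at most $C_{k-1}$, and the number of important $(X,Y,\leq k)^G$-separators is at most $\sum_{i=0}^{k-1}C_i$. Furthermore, both upper bounds are tight: for every $k$ there exist a graph $G$ and sets $X,Y$ for which the number of leftmost $(X,Y,\leq k)^G$-separators equals $C_{k-1}$, and there exist a graph $G$ and sets $X,Y$ for which the number of important $(X,Y,\leq k)^G$-separators equals the stated bound.
   Context: $C_n=\frac{1}{n+1}\binom{2n}{n}$ is the $n$-th Catalan number. A set $S\subseteq V$ is an $(X,Y)^G$-separator if $G-S$ contains no path from a vertex of $X$ to a vertex of $Y$ ($X$, $Y$, $S$ may intersect). For such $S$, $V_{X,S}$ denotes the set of vertices of $G-S$ reachable in $G-S$ from $X\setminus S$, and $V_{S,Y}$ those reachable from $Y\setminus S$. A separator is minimal if no proper subset is an $(X,Y)^G$-separator. Write $S\preceq S'$ if $V_{X,S}\subseteq V_{X,S'}$. An $(X,Y,\leq k)^G$-separator is an $(X,Y)^G$-separator of size at most $k$. $S$ is a leftmost $(X,Y,\leq k)^G$-separator if it is a minimal $(X,Y,\leq k)^G$-separator and no other minimal $(X,Y,\leq k)^G$-separator $S'\neq S$ satisfies $S'\preceq S$. $S'$ dominates $S$ if $|S'|\leq|S|$ and $V_{S,Y}\subsetneq V_{S',Y}$. $S$ is an important $(X,Y,\leq k)^G$-separator if it is a minimal $(X,Y,\leq k)^G$-separator and no other minimal $(X,Y,\leq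 k)^G$-separator dominates $S$. *)

theory Defs
  imports Complex_Main "Graph_Theory.Graph_Theory"
begin

text \<open>
  Graphs are finite, simple and undirected: the locale \<open>graph\<close> of the library, where an
  undirected edge is a pair of opposite arcs.
\<close>

definition catalan :: "nat \<Rightarrow> real" where
  "catalan n = 1 / (real n + 1) * real ((2 * n) choose n)"

definition del_verts :: "('a, 'b) pre_digraph \<Rightarrow> 'a set \<Rightarrow> ('a, 'b) pre_digraph" where
  "del_verts G S = G \<restriction> (verts G - S)"

text \<open>
  A path may consist of a single vertex, so a separator contains \<open>X \<inter> Y\<close>.
\<close>

definition separator :: "('a, 'b) pre_digraph \<Rightarrow> 'a set \<Rightarrow> 'a set \<Rightarrow> 'a set \<Rightarrow> bool" where
  "separator G X Y S \<longleftrightarrow> S \<subseteq> verts G \<and>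
     \<not> (\<exists>x\<in>X. \<exists>y\<in>Y. \<exists>p. pre_digraph.apath (del_verts G S) x p y)"

text \<open>
  \<open>reach_avoiding G X S\<close> is $V_{X,S}$. Since the graph is undirected, $V_{S,Y}$ is
  \<open>reach_avoiding G Y S\<close>.
\<close>

definition reach_avoiding :: "('a, 'b) pre_digraph \<Rightarrow> 'a set \<Rightarrow> 'a set \<Rightarrow> 'a set" where
  "reach_avoiding G X S =
     {v \<in> verts (del_verts G S). \<exists>x \<in> X - S. x \<rightarrow>\<^sup>*\<^bsub>del_verts G S\<^esub> v}"

definition minimal_separator :: "('a, 'b) pre_digraph \<Rightarrow> 'a set \<Rightarrow> 'a set \<Rightarrow> 'a set \<Rightarrow> bool" where
  "minimal_separator G X Y S \<longleftrightarrow>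
     separator G X Y S \<and> \<not> (\<exists>T. T \<subset> S \<and> separator G X Y T)"

definition minimal_separator_le ::
  "('a, 'b) pre_digraph \<Rightarrow> 'a set \<Rightarrow> 'a set \<Rightarrow> nat \<Rightarrow> 'a set \<Rightarrow> bool" where
  "minimal_separator_le G X Y k S \<longleftrightarrow> minimal_separator G X Y S \<and> card S \<le> k"

definition sep_preceq :: "('a, 'b) pre_digraph \<Rightarrow> 'a set \<Rightarrow> 'a set \<Rightarrow> 'a set \<Rightarrow> bool" where
  "sep_preceq G X S S' \<longleftrightarrow> reach_avoiding G X S \<subseteq> reach_avoiding G X S'"

definition leftmost_separator ::
  "('a, 'b) pre_digraph \<Rightarrow> 'a set \<Rightarrow> 'a set \<Rightarrow> nat \<Rightarrow> 'a set \<Rightarrow> bool" where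
  "leftmost_separator G X Y k S \<longleftrightarrow> minimal_separator_le G X Y k S \<and>
     \<not> (\<exists>S'. S' \<noteq> S \<and> minimal_separator_le G X Y k S' \<and> sep_preceq G X S' S)"

definition sep_dominates :: "('a, 'b) pre_digraph \<Rightarrow> 'a set \<Rightarrow> 'a set \<Rightarrow> 'a set \<Rightarrow> bool" where
  "sep_dominates G Y S' S \<longleftrightarrow>
     card S' \<le> card S \<and> reach_avoiding G Y S \<subset> reach_avoiding G Y S'"

definition important_separator ::
  "('a, 'b) pre_digraph \<Rightarrow> 'a set \<Rightarrow> 'a set \<Rightarrow> nat \<Rightarrow> 'a set \<Rightarrow> bool" where
  "important_separator G X Y k S \<longleftrightarrow> minimal_separator_le G X Y k S \<and>
     \<not> (\<exists>S'. S' \<noteq> S \<and> minimal_separator_le G X Y k S' \<and> sep_dominates G Y S' S)"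

end

theory Submission
  imports Defs
begin

text \<open>
  A minimal separator \<open>S\<close> is the outer boundary of its $Y$-side $V_{S,Y}$, and moving \<open>S\<close> to the left
  enlarges this side. So leftmost separators correspond to the maximal sets avoiding \<open>X\<close> that are
  reached from \<open>Y\<close> and have a boundary of size at most \<open>k\<close>. These are counted by branching on a
  boundary vertex of the largest set of minimum boundary, which submodularity puts
  below all maximal sets; the recursion is that of the ballot numbers. An important separator is a
  leftmost separator for the bound given by its own size, hence the sum.

  The bounds are attained by the complete binary tree with \<open>Y\<close> the root and \<open>X\<close> the leaves: a minimal
  separator of size \<open>i\<close> is the frontier of a subtree with \<open>i - 1\<close> inner nodes.
\<close>

section \<open>Ballot numbers\<close>

text \<open>The number of binary forests with \<open>l\<close> trees and \<open>n\<close> inner nodes.\<close>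

fun ballot :: "nat \<Rightarrow> nat \<Rightarrow> nat" where
  "ballot 0 l = 1"
| "ballot (Suc n) 0 = 0"
| "ballot (Suc n) (Suc l) = ballot (Suc n) l + ballot n (l + 2)"

text \<open>The reflection-principle form: by Pascal's rule the difference of binomials satisfies
  the recursion. Integers avoid truncated subtraction, and \<open>Suc n\<close> makes the lower
  index \<open>n\<close> of the second binomial available.\<close>

lemma ballot_Suc_closed_form:
  "int (ballot (Suc n) l) = int ((2 * n + l + 1) choose (Suc n)) - int ((2 * n + l + 1) choose n)"
proof (induction "Suc n" l arbitrary: n rule: ballot.induct)
  case (2 n)
  have "(2 * n + 1) choose (Suc n) = (2 * n + 1) choose n"
    by (subst binomial_symmetric) auto
  then show ?case
    by simp
next
  case (3 n l)
  show ?case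
  proof (cases n)
    case 0
    then show ?thesis
      using 3(1) by simp
  next
    case (Suc m)
    have "int (ballot n (l + 2)) =
        int ((2 * m + (l + 2) + 1) choose (Suc m)) - int ((2 * m + (l + 2) + 1) choose m)"
      using 3(2)[OF Suc] Suc by simp
    then show ?thesis
      using 3(1) Suc by simp
  qed
qed

lemma ballot_1_eq_catalan: "real (ballot n 1) = catalan n"
proof (cases n)
  case 0
  then show ?thesis
    by (simp add: catalan_def)
next
  case (Suc m)
  let ?c = "real ((2 * n) choose n)" and ?d = "real ((2 * n) choose m)"
  have "int (ballot n 1) = int ((2 * n) choose n) - int ((2 * n) choose m)"
    using ballot_Suc_closed_form[of m 1] Suc by simp
  then have "real (ballot n 1) = ?c - ?d"
    by linarith
  \<comment> \<open>Absorption gives the ratio of neighbouring binomials: \<open>?d\<close> is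
    \<open>n / (n + 1)\<close> times \<open>?c\<close>, so the difference is
    \<open>?c / (n + 1)\<close>.\<close>
  moreover have "Suc m * ((2 * n) choose Suc m) = (2 * n - m) * ((2 * n) choose m)"
    using binomial_absorb_comp[of "2 * n" m] binomial_absorption[of m "2 * n"] by simp
  then have "real n * ?c = (real n + 1) * ?d"
    unfolding Suc by (simp flip: of_nat_mult add: algebra_simps)
  then have "(real n + 1) * (?c - ?d) = ?c"
    by (simp add: algebra_simps)
  ultimately have "(real n + 1) * real (ballot n 1) = ?c"
    by simp
  then show ?thesis
    unfolding catalan_def by (simp add: field_simps del: One_nat_def)
qed

lemma ballot_pos: "0 < l \<Longrightarrow> 0 < ballot n l"
  by (induction n l rule: ballot.induct) auto

section \<open>Maximal sets of bounded boundary\<close>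

text \<open>\<open>Y\<close> acts as the neighbourhood of a virtual source, so elements of
  \<open>Y\<close> outside \<open>C\<close> count as boundary. \<open>N\<close> is an arbitrary
  neighbourhood function, so that a vertex can be deleted by removing it from \<open>Y\<close> and
  from all values of \<open>N\<close>.\<close>

definition reach_step :: "('a \<Rightarrow> 'a set) \<Rightarrow> 'a set \<Rightarrow> 'a set \<Rightarrow> 'a set" where
  "reach_step N Y C = Y \<union> \<Union> (N ` C)"

definition boundary :: "('a \<Rightarrow> 'a set) \<Rightarrow> 'a set \<Rightarrow> 'a set \<Rightarrow> 'a set" where
  "boundary N Y C = reach_step N Y C - C"

text \<open>Every element of \<open>C\<close> is reached inside \<open>C\<close> from \<open>B \<union> Y\<close>.\<close>

definition accessible :: "('a \<Rightarrow> 'a set) \<Rightarrow> 'a set \<Rightarrow> 'a set \<Rightarrow> 'a set \<Rightarrow> bool" where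
  "accessible N Y B C \<longleftrightarrow> B \<subseteq> C \<and>
     (\<forall>D. B \<subseteq> D \<and> D \<subseteq> C \<and> reach_step N Y D \<inter> C \<subseteq> D \<longrightarrow> D = C)"

text \<open>\<open>B\<close> holds the vertices already forced in, \<open>U\<close> those still
  allowed; branching enlarges \<open>B\<close> or shrinks \<open>U\<close>.\<close>

definition bounded_sets ::
  "('a \<Rightarrow> 'a set) \<Rightarrow> 'a set \<Rightarrow> 'a set \<Rightarrow> 'a set \<Rightarrow> nat \<Rightarrow> 'a set set" where
  "bounded_sets N Y B U k =
     {C. C \<subseteq> U \<and> accessible N Y B C \<and> card (boundary N Y C) \<le> k}"

definition maximal_bounded_sets ::
  "('a \<Rightarrow> 'a set) \<Rightarrow> 'a set \<Rightarrow> 'a set \<Rightarrow> 'a set \<Rightarrow> nat \<Rightarrow> 'a set set" where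
  "maximal_bounded_sets N Y B U k =
     {C \<in> bounded_sets N Y B U k. \<forall>D \<in> bounded_sets N Y B U k. C \<subseteq> D \<longrightarrow> D = C}"

lemma reach_step_mono: "C \<subseteq> D \<Longrightarrow> reach_step N Y C \<subseteq> reach_step N Y D"
  unfolding reach_step_def by blast

lemma accessible_subset: "accessible N Y B C \<Longrightarrow> B \<subseteq> C"
  unfolding accessible_def by blast

lemma accessibleD:
  "\<lbrakk>accessible N Y B C; B \<subseteq> D; D \<subseteq> C; reach_step N Y D \<inter> C \<subseteq> D\<rbrakk> \<Longrightarrow> D = C"
  unfolding accessible_def by blast

text \<open>The induction principle for accessibility, with \<open>D\<close> free to extend beyond
  \<open>C\<close>; it follows by testing \<open>D \<inter> C\<close>.\<close>

lemma accessible_subset_closed: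
  assumes "accessible N Y B C" "B \<subseteq> D" "reach_step N Y D \<inter> C \<subseteq> D"
  shows "C \<subseteq> D"
proof -
  have "reach_step N Y (D \<inter> C) \<inter> C \<subseteq> D \<inter> C"
    using assms(3) reach_step_mono[of "D \<inter> C" D N Y] by blast
  then have "D \<inter> C = C"
    using accessibleD[OF assms(1), of "D \<inter> C"] assms(2) accessible_subset[OF assms(1)] by blast
  then show ?thesis
    by blast
qed

lemma accessibleI:
  assumes "B \<subseteq> C"
    and "\<And>D. \<lbrakk>B \<subseteq> D; D \<subseteq> C; reach_step N Y D \<inter> C \<subseteq> D\<rbrakk> \<Longrightarrow> C \<subseteq> D"
  shows "accessible N Y B C"
  using assms unfolding accessible_def by blast

lemma accessible_Un:
  assumes "accessible N Y B C" "accessible N Y B D"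
  shows "accessible N Y B (C \<union> D)"
proof (rule accessibleI)
  show "B \<subseteq> C \<union> D"
    using accessible_subset[OF assms(1)] by blast
  fix E assume E: "B \<subseteq> E" "reach_step N Y E \<inter> (C \<union> D) \<subseteq> E"
  show "C \<union> D \<subseteq> E"
    using accessible_subset_closed[OF assms(1) E(1)] accessible_subset_closed[OF assms(2) E(1)]
      E(2) by blast
qed

text \<open>The witness is the intersection of all closed subsets of \<open>C\<close> above
  \<open>B\<close>. A vertex of \<open>C\<close> reached from it belongs to it, so cutting away the
  rest of \<open>C\<close> creates no new boundary.\<close>

lemma accessible_part:
  assumes "B \<subseteq> C"
  shows "\<exists>D \<subseteq> C. accessible N Y B D \<and> boundary N Y D \<subseteq> boundary N Y C \<and>
    reach_step N Y D \<inter> C \<subseteq> D \<and> (\<forall>E \<subseteq> C. accessible N Y B E \<longrightarrow> E \<subseteq> D)"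
proof -
  define F where "F = {D. B \<subseteq> D \<and> D \<subseteq> C \<and> reach_step N Y D \<inter> C \<subseteq> D}"
  define D where "D = \<Inter> F"
  have "C \<in> F"
    using assms by (simp add: F_def)
  then have DC: "D \<subseteq> C"
    unfolding D_def by blast
  have BD: "B \<subseteq> D"
    unfolding D_def F_def by blast
  have closed: "reach_step N Y D \<inter> C \<subseteq> D"
  proof
    fix x assume x: "x \<in> reach_step N Y D \<inter> C"
    have "x \<in> E" if "E \<in> F" for E
    proof -
      have "D \<subseteq> E"
        using that D_def by blast
      then show ?thesis
        using that x reach_step_mono[of D E N Y] unfolding F_def by blast
    qed
    then show "x \<in> D"
      unfolding D_def by blast
  qed
  have acc: "accessible N Y B D"
  proof (rule accessibleI[OF BD])
    fix E assume E: "B \<subseteq> E" "E \<subseteq> D" "reach_step N Y E \<inter> D \<subseteq> E"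
    then have "E \<in> F"
      using closed DC reach_step_mono[of E D N Y] unfolding F_def by blast
    then show "D \<subseteq> E"
      unfolding D_def by blast
  qed
  have "boundary N Y D \<subseteq> boundary N Y C"
    using closed reach_step_mono[OF DC, of N Y] unfolding boundary_def by blast
  moreover have "E \<subseteq> D" if "E \<subseteq> C" "accessible N Y B E" for E
    using accessible_subset_closed[OF that(2) BD] closed that(1) by blast
  ultimately show ?thesis
    using DC acc closed by blast
qed

text \<open>Both the union and the intersection of the two boundaries on the left are contained in
  those on the right; adding the cardinalities gives the inequality.\<close>

lemma boundary_submodular:
  assumes "finite (boundary N Y C)" "finite (boundary N Y D)"
  shows "card (boundary N Y (C \<inter> D)) + card (boundary N Y (C \<union> D))
    \<le> card (boundary N Y C) + card (boundary N Y D)"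
proof -
  let ?b = "boundary N Y"
  have un: "?b (C \<inter> D) \<union> ?b (C \<union> D) \<subseteq> ?b C \<union> ?b D"
    and int: "?b (C \<inter> D) \<inter> ?b (C \<union> D) \<subseteq> ?b C \<inter> ?b D"
    unfolding boundary_def reach_step_def by auto
  have fin: "finite (?b (C \<inter> D))" "finite (?b (C \<union> D))"
    using finite_subset[OF un] assms by auto
  have "card (?b (C \<inter> D)) + card (?b (C \<union> D))
      = card (?b (C \<inter> D) \<union> ?b (C \<union> D)) + card (?b (C \<inter> D) \<inter> ?b (C \<union> D))"
    using card_Un_Int[OF fin] .
  also have "\<dots> \<le> card (?b C \<union> ?b D) + card (?b C \<inter> ?b D)"
    using assms by (intro add_mono card_mono un int) auto
  also have "\<dots> = card (?b C) + card (?b D)"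
    using card_Un_Int[OF assms] by simp
  finally show ?thesis .
qed

lemma finite_boundary:
  "\<lbrakk>finite Y; \<And>c. finite (N c); finite C\<rbrakk> \<Longrightarrow> finite (boundary N Y C)"
  unfolding boundary_def reach_step_def by auto

text \<open>Uncrossing: the intersection already takes \<open>l\<close> of the total
  \<open>k + l\<close> allowed by submodularity, leaving at most \<open>k\<close> for the
  union.\<close>

lemma bounded_sets_Un:
  assumes "finite Y" "\<And>c. finite (N c)" "finite U"
    and "\<And>D. \<lbrakk>B \<subseteq> D; D \<subseteq> U\<rbrakk> \<Longrightarrow> l \<le> card (boundary N Y D)"
    and "C \<in> bounded_sets N Y B U k" "L \<in> bounded_sets N Y B U l"
  shows "C \<union> L \<in> bounded_sets N Y B U k"
proof -
  have C: "C \<subseteq> U" "accessible N Y B C" "card (boundary N Y C) \<le> k"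
    and L: "L \<subseteq> U" "accessible N Y B L" "card (boundary N Y L) \<le> l"
    using assms(5,6) unfolding bounded_sets_def by auto
  have "finite (boundary N Y C)" "finite (boundary N Y L)"
    by (intro finite_boundary assms(1,2) finite_subset[OF _ assms(3)] C(1) L(1))+
  moreover have "l \<le> card (boundary N Y (C \<inter> L))"
    using assms(4)[of "C \<inter> L"] C L accessible_subset by blast
  ultimately have "card (boundary N Y (C \<union> L)) \<le> k"
    using boundary_submodular[of N Y C L] C(3) L(3) by linarith
  then show ?thesis
    using C L accessible_Un unfolding bounded_sets_def by blast
qed

lemma finite_bounded_sets: "finite U \<Longrightarrow> finite (bounded_sets N Y B U k)"
  unfolding bounded_sets_def by (rule finite_subset[of _ "Pow U"]) auto

lemma finite_maximal_bounded_sets: "finite U \<Longrightarrow> finite (maximal_bounded_sets N Y B U k)"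
  unfolding maximal_bounded_sets_def by (simp add: finite_bounded_sets)

text \<open>A set that contains \<open>L\<close> but not \<open>v\<close> has \<open>v\<close> on
  its boundary, so deleting \<open>v\<close> lowers its boundary by exactly one and leaves its
  accessibility unchanged. All competitors of \<open>C\<close> contain \<open>L\<close>, so
  maximality carries over.\<close>

lemma maximal_bounded_sets_delete:
  assumes C: "C \<in> maximal_bounded_sets N Y B U (Suc k)"
    and L: "L \<subseteq> C" and v: "v \<in> boundary N Y L" "v \<notin> C"
    and fin: "finite Y" "\<And>c. finite (N c)" "finite U"
  shows "C \<in> maximal_bounded_sets (\<lambda>c. N c - {v}) (Y - {v}) B (U - {v}) k"
proof -
  let ?N = "\<lambda>c. N c - {v}" and ?Y = "Y - {v}"
  have b: "boundary ?N ?Y D = boundary N Y D - {v}" for D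
    unfolding boundary_def reach_step_def by auto
  have acc: "accessible ?N ?Y B D \<longleftrightarrow> accessible N Y B D" if "v \<notin> D" for D
  proof -
    have "reach_step ?N ?Y E \<inter> D = reach_step N Y E \<inter> D" for E
      using that unfolding reach_step_def by auto
    then show ?thesis
      unfolding accessible_def by simp
  qed
  have bounded: "D \<in> bounded_sets ?N ?Y B (U - {v}) k \<longleftrightarrow>
      v \<notin> D \<and> D \<in> bounded_sets N Y B U (Suc k)" if "L \<subseteq> D" for D
  proof (cases "v \<notin> D \<and> D \<subseteq> U")
    case True
    then have "v \<in> boundary N Y D"
      using v(1) reach_step_mono[OF that, of N Y] unfolding boundary_def by blast
    moreover have "finite (boundary N Y D)"
      using True by (intro finite_boundary fin finite_subset[OF _ fin(3)]) simp
    ultimately have "card (boundary N Y D) = Suc (card (boundary N Y D - {v}))"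
      using card.remove by metis
    then show ?thesis
      using True acc unfolding bounded_sets_def by (auto simp: b)
  qed (auto simp: bounded_sets_def)
  have "D = C" if "D \<in> bounded_sets ?N ?Y B (U - {v}) k" "C \<subseteq> D" for D
    using that C bounded[OF subset_trans[OF L that(2)]] unfolding maximal_bounded_sets_def by simp
  moreover have "C \<in> bounded_sets ?N ?Y B (U - {v}) k"
    using C v(2) bounded[OF L] unfolding maximal_bounded_sets_def by simp
  ultimately show ?thesis
    unfolding maximal_bounded_sets_def by simp
qed

text \<open>Since \<open>L\<close> is accessible from \<open>B\<close> and \<open>v\<close> is
  reached from \<open>L\<close>, whatever is accessible from \<open>insert v L\<close> is accessible
  from \<open>B\<close>. The new competitors of \<open>C\<close> are thus among the old
  ones.\<close>

lemma maximal_bounded_sets_insert: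
  assumes C: "C \<in> maximal_bounded_sets N Y B U k"
    and L: "L \<subseteq> C" "accessible N Y B L" and v: "v \<in> boundary N Y L" "v \<in> C"
  shows "C \<in> maximal_bounded_sets N Y (insert v L) U k"
proof -
  have acc: "accessible N Y B D" if "accessible N Y (insert v L) D" for D
  proof (rule accessibleI)
    have sub: "insert v L \<subseteq> D"
      using accessible_subset[OF that] .
    then show "B \<subseteq> D"
      using accessible_subset[OF L(2)] by blast
    fix E assume E: "B \<subseteq> E" "reach_step N Y E \<inter> D \<subseteq> E"
    have "L \<subseteq> E"
      using accessible_subset_closed[OF L(2) E(1)] E(2) sub by blast
    moreover have "v \<in> E"
      using E(2) sub v(1) reach_step_mono[OF \<open>L \<subseteq> E\<close>, of N Y] unfolding boundary_def by blast
    ultimately show "D \<subseteq> E"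
      using accessible_subset_closed[OF that] E(2) by blast
  qed
  have "accessible N Y B C"
    using C unfolding maximal_bounded_sets_def bounded_sets_def by simp
  then have "accessible N Y (insert v L) C"
    using L(1) v(2) accessible_subset[OF L(2)]
    by (intro accessibleI) (auto elim!: accessible_subset_closed[THEN subsetD])
  moreover have "bounded_sets N Y (insert v L) U k \<subseteq> bounded_sets N Y B U k"
    using acc unfolding bounded_sets_def by blast
  moreover have "C \<subseteq> U" "card (boundary N Y C) \<le> k"
    using C unfolding maximal_bounded_sets_def bounded_sets_def by simp_all
  ultimately show ?thesis
    using C unfolding maximal_bounded_sets_def bounded_sets_def[of N Y "insert v L"] by blast
qed

text \<open>
  Let \<open>L\<close> be the largest accessible set whose boundary has the minimum size \<open>l\<close>, and
  \<open>v \<in> boundary N Y L\<close>. By submodularity every maximal set \<open>C\<close> contains \<open>L\<close>. If \<open>v \<notin> C\<close>, then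
  \<open>v\<close> is deleted, which lowers both \<open>k\<close> and \<open>l\<close> by one. If \<open>v \<in> C\<close>, then \<open>v\<close> joins the base, which
  raises \<open>l\<close>. For \<open>l = 1\<close> the first case leaves only \<open>C = L\<close>, which then is the only
  maximal set; this is what makes the bound a single Catalan number instead of a sum.
\<close>

lemma card_maximal_bounded_sets_le_ballot:
  assumes "finite Y" "\<And>c. finite (N c)" "finite U" "0 < l"
    and "\<And>C. \<lbrakk>B \<subseteq> C; C \<subseteq> U\<rbrakk> \<Longrightarrow> l \<le> card (boundary N Y C)"
  shows "card (maximal_bounded_sets N Y B U (n + l)) \<le> ballot n l"
  using assms
proof (induction n l arbitrary: N Y B U rule: ballot.induct)
  case (1 l)
  \<comment> \<open>For \<open>n = 0\<close> the size bound equals the minimum, so uncrossing makes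
    the union of two maximal sets a competitor of both.\<close>
  have "C = D" if "C \<in> maximal_bounded_sets N Y B U l" "D \<in> maximal_bounded_sets N Y B U l" for C D
  proof -
    have "C \<union> D \<in> bounded_sets N Y B U l"
      using that bounded_sets_Un[OF 1(1-3,5), where C = C and L = D and k = l]
      unfolding maximal_bounded_sets_def by simp
    then have "C \<union> D = C" "C \<union> D = D"
      using that unfolding maximal_bounded_sets_def by auto
    then show ?thesis by simp
  qed
  then show ?case
    using card_le_Suc0_iff_eq[OF finite_maximal_bounded_sets[OF \<open>finite U\<close>], of N Y B l]
    by auto
next
  case (2 n)
  then show ?case by simp
next
  case (3 n l)
  note fin = 3(3-5)
  let ?b = "boundary N Y" and ?k = "Suc n + Suc l"
  let ?M = "maximal_bounded_sets N Y B U ?k"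
  \<comment> \<open>Raising the lower bound from \<open>Suc l\<close> to \<open>l + 2\<close> costs
    one unit of the first argument while the size bound stays.\<close>
  have k: "n + (l + 2) = ?k"
    by simp
  show ?case
  proof (cases "\<exists>C. B \<subseteq> C \<and> C \<subseteq> U \<and> card (?b C) = Suc l")
    case False
    \<comment> \<open>The minimum is not attained, so the lower bound improves without
      branching.\<close>
    have "l + 2 \<le> card (?b C)" if "B \<subseteq> C" "C \<subseteq> U" for C
    proof -
      have "card (?b C) \<noteq> Suc l"
        using False that by blast
      then show ?thesis
        using 3(7)[OF that] by simp
    qed
    then have "card ?M \<le> ballot n (l + 2)"
      using 3(2)[OF fin, of B] unfolding k by simp
    then show ?thesis by simp
  next
    case True
    then obtain C0 where C0: "B \<subseteq> C0" "C0 \<subseteq> U" "card (?b C0) = Suc l"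
      by blast
    have finb: "finite (?b C)" if "C \<subseteq> U" for C
      by (intro finite_boundary fin finite_subset[OF that fin(3)])
    obtain D0 where D0: "D0 \<subseteq> C0" "accessible N Y B D0" "?b D0 \<subseteq> ?b C0"
      using accessible_part[OF C0(1), of N Y] by blast
    have "D0 \<in> bounded_sets N Y B U (Suc l)"
      using D0(1,2) C0 card_mono[OF finb[OF C0(2)] D0(3)] unfolding bounded_sets_def by auto
    \<comment> \<open>A maximal element suffices; by \<open>bounded_sets_Un\<close> it is the
      largest one.\<close>
    then obtain L where L: "L \<in> bounded_sets N Y B U (Suc l)"
      and Lmax: "\<And>C. \<lbrakk>C \<in> bounded_sets N Y B U (Suc l); L \<subseteq> C\<rbrakk> \<Longrightarrow> L = C"
      using finite_has_maximal[OF finite_bounded_sets[OF fin(3), of N Y B "Suc l"]] by blast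
    have LU: "L \<subseteq> U" "accessible N Y B L" "card (?b L) = Suc l"
      using L 3(7)[of L] accessible_subset[of N Y B L] unfolding bounded_sets_def by auto
    have LC: "L \<subseteq> C" if "C \<in> ?M" for C
      using that bounded_sets_Un[OF fin 3(7), where C = C and L = L and k = ?k] L
      unfolding maximal_bounded_sets_def by blast
    obtain v where v: "v \<in> ?b L"
      using LU(3) by fastforce
    have IH2: "card (maximal_bounded_sets N Y (insert v L) U ?k) \<le> ballot n (l + 2)"
    proof -
      \<comment> \<open>Otherwise the accessible part of \<open>C\<close> would be a set of minimum
        boundary containing both \<open>L\<close> and \<open>v\<close>, against the choice of
        \<open>L\<close>.\<close>
      have "l + 2 \<le> card (?b C)" if C: "insert v L \<subseteq> C" "C \<subseteq> U" for C
      proof (rule ccontr)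
        assume "\<not> l + 2 \<le> card (?b C)"
        then have small: "card (?b C) \<le> Suc l" by simp
        have "B \<subseteq> C"
          using accessible_subset[OF LU(2)] C(1) by blast
        then obtain D where D: "D \<subseteq> C" "accessible N Y B D" "?b D \<subseteq> ?b C"
          "\<forall>E \<subseteq> C. accessible N Y B E \<longrightarrow> E \<subseteq> D" "reach_step N Y D \<inter> C \<subseteq> D"
          using accessible_part[of B C N Y] by blast
        have LD: "L \<subseteq> D"
          using D(4) LU(2) C(1) by blast
        have "v \<in> D"
          using D(5) reach_step_mono[OF LD, of N Y] v C(1) unfolding boundary_def by blast
        moreover have "D \<in> bounded_sets N Y B U (Suc l)"
          using D(1,2) C(2) small card_mono[OF finb[OF C(2)] D(3)] unfolding bounded_sets_def by auto
        ultimately show False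
          using Lmax[OF _ LD] v unfolding boundary_def by blast
      qed
      then show ?thesis
        using 3(2)[OF fin, of "insert v L"] unfolding k by simp
    qed
    have ins: "C \<in> maximal_bounded_sets N Y (insert v L) U ?k" if "C \<in> ?M" "v \<in> C" for C
      using maximal_bounded_sets_insert[OF that(1) LC[OF that(1)] LU(2) v that(2)] .
    have fin2: "finite (maximal_bounded_sets N Y (insert v L) U ?k)"
      using fin(3) by (rule finite_maximal_bounded_sets)
    show ?thesis
    proof (cases l)
      case 0
      then have bL: "?b L = {v}"
        using LU(3) v by (auto simp: card_Suc_eq)
      \<comment> \<open>With \<open>v\<close> the only way out of \<open>L\<close>, a set that
        misses \<open>v\<close> cannot extend beyond \<open>L\<close>.\<close>
      have onlyL: "C = L" if "C \<in> ?M" "v \<notin> C" for C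
      proof -
        have "reach_step N Y L \<inter> C \<subseteq> L"
          using equalityD1[OF bL] that(2) unfolding boundary_def by blast
        then have "C \<subseteq> L"
          using accessible_subset_closed[of N Y B C L] that(1) accessible_subset[OF LU(2)]
          unfolding maximal_bounded_sets_def bounded_sets_def by blast
        then show ?thesis
          using LC[OF that(1)] by blast
      qed
      show ?thesis
      \<comment> \<open>If \<open>L\<close> is maximal, it is the only member of \<open>?M\<close>,
        as all members contain it; otherwise every member contains \<open>v\<close>. So the two
        branches never add up, in line with \<open>ballot (Suc n) 0 = 0\<close>.\<close>
      proof (cases "L \<in> ?M")
        case True
        have "C = L" if "C \<in> ?M" for C
          using LC[OF that] that True unfolding maximal_bounded_sets_def by blast
        then have "card ?M \<le> card {L}"
          by (intro card_mono) auto
        then show ?thesis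
          using ballot_pos[of "Suc l" "Suc n"] by (simp del: ballot.simps)
      next
        case False
        then have "?M \<subseteq> maximal_bounded_sets N Y (insert v L) U ?k"
          using onlyL ins by blast
        then have "card ?M \<le> ballot n (l + 2)"
          using card_mono[OF fin2] IH2 le_trans by blast
        then show ?thesis by simp
      qed
    next
      case (Suc l')
      let ?N = "\<lambda>c. N c - {v}" and ?Y = "Y - {v}"
      let ?M' = "maximal_bounded_sets ?N ?Y B (U - {v}) (Suc n + l)"
      have lower: "l \<le> card (boundary ?N ?Y C)" if C: "B \<subseteq> C" "C \<subseteq> U - {v}" for C
      proof -
        have "boundary ?N ?Y C = ?b C - {v}"
          unfolding boundary_def reach_step_def by auto
        moreover have "card (?b C) \<le> Suc (card (?b C - {v}))"
          by (cases "v \<in> ?b C") (simp_all add: card_Diff_singleton)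
        moreover have "Suc l \<le> card (?b C)"
          using C by (intro 3(7)) blast+
        ultimately show ?thesis
          by simp
      qed
      have IH1: "card ?M' \<le> ballot (Suc n) l"
      proof (rule 3(1))
        show "finite ?Y" "finite (U - {v})" "\<And>c. finite (N c - {v})"
          using fin by simp_all
        show "0 < l"
          using Suc by simp
      qed (rule lower)
      have "C \<in> ?M'" if "C \<in> ?M" "v \<notin> C" for C
        using maximal_bounded_sets_delete[OF _ LC[OF that(1)] v that(2) fin] that(1) by simp
      then have "?M \<subseteq> ?M' \<union> maximal_bounded_sets N Y (insert v L) U ?k"
        using ins by blast
      moreover have "finite ?M'"
        using fin(3) by (intro finite_maximal_bounded_sets) simp
      ultimately have "card ?M \<le> card (?M' \<union> maximal_bounded_sets N Y (insert v L) U ?k)"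
        using fin2 by (intro card_mono) auto
      also have "\<dots> \<le> card ?M' + card (maximal_bounded_sets N Y (insert v L) U ?k)"
        by (rule card_Un_le)
      finally show ?thesis
        using IH1 IH2 by simp
    qed
  qed
qed

section \<open>Leftmost separators as maximal sets\<close>

definition nbrs :: "('a, 'b) pre_digraph \<Rightarrow> 'a \<Rightarrow> 'a set" where
  "nbrs G u = {v. u \<rightarrow>\<^bsub>G\<^esub> v}"

lemma (in graph) nbrs_subset: "nbrs G u \<subseteq> verts G"
  unfolding nbrs_def using adj_in_verts by blast

lemma (in graph) nbrs_sym: "v \<in> nbrs G u \<Longrightarrow> u \<in> nbrs G v"
  unfolding nbrs_def using arcs_ends_symmetric[OF sym_arcs] by simp

lemma (in graph) finite_nbrs: "finite (nbrs G u)"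
  using nbrs_subset finite_verts by (rule finite_subset)

lemma (in graph) del_verts_dominates_iff:
  "u \<rightarrow>\<^bsub>del_verts G S\<^esub> v \<longleftrightarrow> v \<in> nbrs G u \<and> u \<notin> S \<and> v \<notin> S"
  unfolding del_verts_def nbrs_def arcs_ends_conv by (auto simp: image_iff)

lemma (in graph) wf_del_verts: "wf_digraph (del_verts G S)"
  unfolding del_verts_def by (rule wellformed_induce_subgraph)

lemma (in graph) reach_avoiding_disjoint: "reach_avoiding G Y S \<inter> S = {}"
  unfolding reach_avoiding_def del_verts_def by auto

lemma (in graph) reach_avoiding_closed:
  assumes "Y \<subseteq> verts G"
  shows "reach_step (nbrs G) Y (reach_avoiding G Y S) - S \<subseteq> reach_avoiding G Y S"
proof
  interpret H: wf_digraph "del_verts G S"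
    by (rule wf_del_verts)
  have vH: "verts (del_verts G S) = verts G - S"
    unfolding del_verts_def by simp
  fix w assume w: "w \<in> reach_step (nbrs G) Y (reach_avoiding G Y S) - S"
  then consider "w \<in> Y" | u where "u \<in> reach_avoiding G Y S" "w \<in> nbrs G u"
    unfolding reach_step_def by blast
  then show "w \<in> reach_avoiding G Y S"
  proof cases
    case 1
    then show ?thesis
      using w assms vH H.reachable_refl[of w] unfolding reach_avoiding_def by auto
  next
    case 2
    have "u \<notin> S"
      using 2(1) reach_avoiding_disjoint by blast
    then have "u \<rightarrow>\<^bsub>del_verts G S\<^esub> w"
      using 2(2) w del_verts_dominates_iff by blast
    then show ?thesis
      using 2 w vH nbrs_subset H.reachable_adj_trans unfolding reach_avoiding_def by blast
  qed
qed

text \<open>Induction along walks in \<open>G - S\<close>. Together with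
  \<open>reach_avoiding_closed\<close> it replaces walks when sides are compared below.\<close>

lemma (in graph) reach_avoiding_least:
  assumes "Y - S \<subseteq> D" "\<And>u w. \<lbrakk>u \<in> D; u \<notin> S; w \<in> nbrs G u; w \<notin> S\<rbrakk> \<Longrightarrow> w \<in> D"
  shows "reach_avoiding G Y S \<subseteq> D"
proof
  interpret H: wf_digraph "del_verts G S"
    by (rule wf_del_verts)
  fix v assume "v \<in> reach_avoiding G Y S"
  then obtain y where y: "y \<in> Y - S" "y \<rightarrow>\<^sup>*\<^bsub>del_verts G S\<^esub> v"
    unfolding reach_avoiding_def by blast
  from y(2) show "v \<in> D"
  proof (induction rule: H.reachable_induct)
    case base
    then show ?case
      using y(1) assms(1) by blast
  next
    case (step u w)
    then show ?case
      using assms(2) del_verts_dominates_iff by blast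
  qed
qed

lemma (in graph) separator_iff:
  assumes "X \<subseteq> verts G" "Y \<subseteq> verts G"
  shows "separator G X Y S \<longleftrightarrow> S \<subseteq> verts G \<and> reach_avoiding G X S \<inter> Y = {}"
proof -
  interpret H: wf_digraph "del_verts G S"
    by (rule wf_del_verts)
  have "(\<exists>p. H.apath x p y) \<longleftrightarrow> x \<rightarrow>\<^sup>*\<^bsub>del_verts G S\<^esub> y" for x y
    using H.reachable_apath by blast
  moreover have "x \<notin> S" if "x \<rightarrow>\<^sup>*\<^bsub>del_verts G S\<^esub> y" for x y
    using H.reachable_in_verts(1)[OF that] unfolding del_verts_def by simp
  ultimately show ?thesis
    unfolding separator_def reach_avoiding_def using H.reachable_in_verts(2) by blast
qed

lemma (in graph) separator_commute:
  assumes "X \<subseteq> verts G" "Y \<subseteq> verts G"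
  shows "separator G X Y S \<longleftrightarrow> separator G Y X S"
proof -
  have "symmetric (del_verts G S)"
    unfolding symmetric_def sym_def using del_verts_dominates_iff nbrs_sym by blast
  then have "x \<rightarrow>\<^sup>*\<^bsub>del_verts G S\<^esub> y \<longleftrightarrow> y \<rightarrow>\<^sup>*\<^bsub>del_verts G S\<^esub> x" for x y
    using symmetric_reachable by metis
  moreover have "x \<notin> S \<and> x \<in> verts (del_verts G S)" if "x \<rightarrow>\<^sup>*\<^bsub>del_verts G S\<^esub> y" for x y
    using wf_digraph.reachable_in_verts(1)[OF wf_del_verts that] unfolding del_verts_def by simp
  ultimately show ?thesis
    unfolding separator_iff[OF assms] separator_iff[OF assms(2,1)] reach_avoiding_def by blast
qed

lemma (in graph) minimal_separator_commute:
  assumes "X \<subseteq> verts G" "Y \<subseteq> verts G"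
  shows "minimal_separator G X Y S \<longleftrightarrow> minimal_separator G Y X S"
  unfolding minimal_separator_def using separator_commute[OF assms] by simp

section \<open>Separators and the boundaries of their \<open>Y\<close>-sides\<close>

locale terminals = graph G for G :: "('a, 'b) pre_digraph" (structure) +
  fixes X Y :: "'a set"
  assumes X_verts: "X \<subseteq> verts G" and Y_verts: "Y \<subseteq> verts G"
begin

lemma separator_iff_Y: "separator G X Y S \<longleftrightarrow> S \<subseteq> verts G \<and> reach_avoiding G Y S \<inter> X = {}"
  using separator_commute[OF X_verts Y_verts] separator_iff[OF Y_verts X_verts] by simp

lemma reach_avoiding_antimono:
  assumes "T \<subseteq> S"
  shows "reach_avoiding G Y S \<subseteq> reach_avoiding G Y T"
proof (rule reach_avoiding_least)
  have "Y - T \<subseteq> reach_avoiding G Y T"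
    using reach_avoiding_closed[OF Y_verts, of T] unfolding reach_step_def by blast
  then show "Y - S \<subseteq> reach_avoiding G Y T"
    using assms by blast
  show "w \<in> reach_avoiding G Y T" if "u \<in> reach_avoiding G Y T" "w \<in> nbrs G u" "w \<notin> S" for u w
    using that assms reach_avoiding_closed[OF Y_verts, of T] unfolding reach_step_def by blast
qed

lemma boundary_reach_avoiding_subset: "boundary (nbrs G) Y (reach_avoiding G Y S) \<subseteq> S"
  using reach_avoiding_closed[OF Y_verts, of S] unfolding boundary_def by blast

lemma boundary_subset_verts: "boundary (nbrs G) Y C \<subseteq> verts G"
  using nbrs_subset Y_verts unfolding boundary_def reach_step_def by blast

text \<open>A walk from \<open>Y\<close> that avoids the boundary of \<open>C\<close> starts in
  \<open>C\<close> and can never leave it.\<close>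

lemma reach_avoiding_boundary_subset: "reach_avoiding G Y (boundary (nbrs G) Y C) \<subseteq> C"
  by (rule reach_avoiding_least) (auto simp: boundary_def reach_step_def)

lemma separator_boundary:
  assumes "C \<subseteq> verts G - X"
  shows "separator G X Y (boundary (nbrs G) Y C)"
  unfolding separator_iff_Y
  using boundary_subset_verts reach_avoiding_boundary_subset[of C] assms by blast

lemma reach_avoiding_subset:
  assumes "separator G X Y S"
  shows "reach_avoiding G Y S \<subseteq> verts G - X"
  using assms unfolding separator_iff_Y reach_avoiding_def del_verts_def by auto

lemma accessible_reach_avoiding: "accessible (nbrs G) Y {} (reach_avoiding G Y S)"
proof (rule accessibleI)
  fix D assume D: "D \<subseteq> reach_avoiding G Y S"
    "reach_step (nbrs G) Y D \<inter> reach_avoiding G Y S \<subseteq> D"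
  have closed: "reach_step (nbrs G) Y D - S \<subseteq> D"
    using D reach_step_mono[OF D(1), of "nbrs G" Y] reach_avoiding_closed[OF Y_verts, of S] by blast
  show "reach_avoiding G Y S \<subseteq> D"
    by (rule reach_avoiding_least) (use closed in \<open>auto simp: reach_step_def\<close>)
qed simp

text \<open>No part of an accessible set is cut off from \<open>Y\<close>, so nothing is lost when
  the boundary is removed. Hence such sets are determined by their boundaries.\<close>

lemma reach_avoiding_boundary:
  assumes "accessible (nbrs G) Y {} C"
  shows "reach_avoiding G Y (boundary (nbrs G) Y C) = C"
proof -
  let ?R = "reach_avoiding G Y (boundary (nbrs G) Y C)"
  have "reach_step (nbrs G) Y ?R \<inter> C \<subseteq> ?R"
    using reach_avoiding_closed[OF Y_verts, of "boundary (nbrs G) Y C"]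
    unfolding boundary_def by blast
  then show ?thesis
    using accessibleD[OF assms _ reach_avoiding_boundary_subset] by blast
qed

lemma inj_on_boundary: "inj_on (boundary (nbrs G) Y) {C. accessible (nbrs G) Y {} C}"
  by (rule inj_on_inverseI[of _ "reach_avoiding G Y"]) (simp add: reach_avoiding_boundary)

text \<open>The boundary of the \<open>Y\<close>-side lies in \<open>S\<close> and itself separates,
  so minimality forces equality. A minimal separator is thus determined by its
  \<open>Y\<close>-side.\<close>

lemma minimal_separator_eq_boundary:
  assumes "minimal_separator G X Y S"
  shows "S = boundary (nbrs G) Y (reach_avoiding G Y S)"
proof -
  have "separator G X Y S"
    using assms unfolding minimal_separator_def by blast
  then have "separator G X Y (boundary (nbrs G) Y (reach_avoiding G Y S))"
    by (intro separator_boundary reach_avoiding_subset)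
  then show ?thesis
    using assms boundary_reach_avoiding_subset[of S] unfolding minimal_separator_def by blast
qed

lemma minimal_separator_subset_verts: "minimal_separator G X Y S \<Longrightarrow> S \<subseteq> verts G"
  unfolding minimal_separator_def separator_def by blast

lemma separator_finite: "separator G X Y S \<Longrightarrow> finite S"
  unfolding separator_def using finite_subset[OF _ finite_verts] by blast

lemma minimal_separator_exists:
  assumes "separator G X Y S"
  shows "\<exists>T \<subseteq> S. minimal_separator G X Y T"
proof -
  let ?F = "{T. T \<subseteq> S \<and> separator G X Y T}"
  have "finite ?F" "S \<in> ?F"
    using separator_finite[OF assms] assms by simp_all
  then obtain T where T: "T \<in> ?F" "\<forall>T' \<in> ?F. T' \<subseteq> T \<longrightarrow> T = T'"
    using finite_has_minimal2[of ?F S] by auto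
  then have "minimal_separator G X Y T"
    unfolding minimal_separator_def by blast
  then show ?thesis
    using T(1) by blast
qed

lemma reach_avoiding_sides_disjoint:
  assumes "separator G X Y S"
  shows "reach_avoiding G X S \<inter> reach_avoiding G Y S = {}"
proof -
  let ?R = "reach_avoiding G Y S"
  have cl: "reach_step (nbrs G) Y ?R - S \<subseteq> ?R"
    by (rule reach_avoiding_closed[OF Y_verts])
  \<comment> \<open>Adjacency is symmetric, so outside \<open>S\<close> the complement of the
    \<open>Y\<close>-side is closed as well.\<close>
  have "reach_avoiding G X S \<subseteq> - ?R"
  proof (rule reach_avoiding_least)
    show "X - S \<subseteq> - ?R"
      using assms unfolding separator_iff_Y by blast
    show "w \<in> - ?R" if "u \<in> - ?R" "u \<notin> S" "w \<in> nbrs G u" for u w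
      using that cl nbrs_sym unfolding reach_step_def by blast
  qed
  then show ?thesis by blast
qed

end

section \<open>The separator order seen from either side\<close>

lemma (in terminals) terminals_swap: "terminals G Y X"
  using X_verts Y_verts by unfold_locales

text \<open>As the boundary of its own \<open>X\<close>-side, \<open>S\<close> is reached from the
  larger \<open>X\<close>-side of \<open>T\<close>. So \<open>S - T\<close> lies in that side, and
  no walk from \<open>Y\<close> in \<open>G - T\<close> meets \<open>S\<close>.\<close>

lemma (in terminals) reach_avoiding_other_side:
  assumes S: "minimal_separator G X Y S" and T: "separator G X Y T"
    and le: "reach_avoiding G X S \<subseteq> reach_avoiding G X T"
  shows "reach_avoiding G Y T \<subseteq> reach_avoiding G Y S"
proof -
  interpret swap: terminals G Y X
    by (rule terminals_swap)
  have "S \<subseteq> reach_step (nbrs G) X (reach_avoiding G X S)"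
    using swap.minimal_separator_eq_boundary[of S] S
      minimal_separator_commute[OF X_verts Y_verts] unfolding boundary_def by blast
  then have ST: "S - T \<subseteq> reach_avoiding G X T"
    using reach_step_mono[OF le, of "nbrs G" X] reach_avoiding_closed[OF X_verts, of T] by blast
  have clT: "reach_step (nbrs G) Y (reach_avoiding G Y T) - T \<subseteq> reach_avoiding G Y T"
    and clS: "reach_step (nbrs G) Y (reach_avoiding G Y S) - S \<subseteq> reach_avoiding G Y S"
    by (rule reach_avoiding_closed[OF Y_verts])+
  have dis: "reach_avoiding G X T \<inter> reach_avoiding G Y T = {}"
    by (rule reach_avoiding_sides_disjoint[OF T])
  have "reach_avoiding G Y T \<subseteq> reach_avoiding G Y S \<inter> reach_avoiding G Y T"
  proof (rule reach_avoiding_least)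
    show "Y - T \<subseteq> reach_avoiding G Y S \<inter> reach_avoiding G Y T"
      using clT clS ST dis unfolding reach_step_def by blast
    show "w \<in> reach_avoiding G Y S \<inter> reach_avoiding G Y T"
      if "u \<in> reach_avoiding G Y S \<inter> reach_avoiding G Y T" "w \<in> nbrs G u" "w \<notin> T" for u w
      using that clT clS ST dis unfolding reach_step_def by blast
  qed
  then show ?thesis by blast
qed

context terminals
begin

text \<open>Apply the preceding inclusion twice, once with \<open>X\<close> and \<open>Y\<close>
  exchanged. This moves the order to the \<open>Y\<close>-sides, where domination is
  measured.\<close>

lemma sep_preceq_iff:
  assumes S: "minimal_separator G X Y S" and T: "minimal_separator G X Y T"
  shows "sep_preceq G X S T \<longleftrightarrow> reach_avoiding G Y T \<subseteq> reach_avoiding G Y S"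
proof -
  interpret swap: terminals G Y X
    by (rule terminals_swap)
  have "minimal_separator G Y X T" "separator G Y X S" "separator G X Y T"
    using S T minimal_separator_commute[OF X_verts Y_verts] minimal_separator_def by metis+
  then show ?thesis
    using reach_avoiding_other_side[OF S, of T] swap.reach_avoiding_other_side[of T S]
    unfolding sep_preceq_def by blast
qed

lemma leftmost_separator_iff:
  "leftmost_separator G X Y k S \<longleftrightarrow> minimal_separator_le G X Y k S \<and>
     (\<forall>T. minimal_separator_le G X Y k T \<and> reach_avoiding G Y S \<subseteq> reach_avoiding G Y T \<longrightarrow> T = S)"
  unfolding leftmost_separator_def minimal_separator_le_def using sep_preceq_iff by blast

text \<open>Domination asks for strict inclusion of \<open>Y\<close>-sides; between distinct minimal
  separators every inclusion is strict, since the \<open>Y\<close>-side determines the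
  separator.\<close>

lemma important_separator_iff:
  "important_separator G X Y k S \<longleftrightarrow> leftmost_separator G X Y (card S) S \<and> card S \<le> k"
proof -
  have "T = S" if "minimal_separator G X Y S" "minimal_separator G X Y T"
    "reach_avoiding G Y S = reach_avoiding G Y T" for T
    using that minimal_separator_eq_boundary by metis
  then show ?thesis
    unfolding important_separator_def leftmost_separator_iff minimal_separator_le_def
      sep_dominates_def
    by (auto simp: psubset_eq)
qed

section \<open>Leftmost separators and maximal bounded sets\<close>

abbreviation "leftmost_sets k \<equiv> maximal_bounded_sets (nbrs G) Y {} (verts G - X) k"

lemma reach_avoiding_leftmost:
  assumes "leftmost_separator G X Y k S"
  shows "reach_avoiding G Y S \<in> leftmost_sets k"
proof -
  have S: "minimal_separator G X Y S" "card S \<le> k"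
    and max: "\<And>T. \<lbrakk>minimal_separator G X Y T; card T \<le> k;
      reach_avoiding G Y S \<subseteq> reach_avoiding G Y T\<rbrakk> \<Longrightarrow> T = S"
    using assms unfolding leftmost_separator_iff minimal_separator_le_def by blast+
  have "separator G X Y S"
    using S(1) unfolding minimal_separator_def by blast
  then have "reach_avoiding G Y S \<in> bounded_sets (nbrs G) Y {} (verts G - X) k"
    using S(2) reach_avoiding_subset accessible_reach_avoiding
      minimal_separator_eq_boundary[OF S(1)] unfolding bounded_sets_def by auto
  moreover have "C = reach_avoiding G Y S"
    if C: "C \<in> bounded_sets (nbrs G) Y {} (verts G - X) k" "reach_avoiding G Y S \<subseteq> C" for C
  proof -
    have CU: "C \<subseteq> verts G - X" "accessible (nbrs G) Y {} C" "card (boundary (nbrs G) Y C) \<le> k"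
      using C(1) unfolding bounded_sets_def by auto
    \<comment> \<open>The boundary of \<open>C\<close> may fail to be a minimal separator; thinning
      it out to \<open>T\<close> only enlarges the \<open>Y\<close>-side.\<close>
    obtain T where T: "T \<subseteq> boundary (nbrs G) Y C" "minimal_separator G X Y T"
      using minimal_separator_exists[OF separator_boundary[OF CU(1)]] by blast
    have CT: "C \<subseteq> reach_avoiding G Y T"
      using reach_avoiding_antimono[OF T(1)] reach_avoiding_boundary[OF CU(2)] by simp
    have "card T \<le> k"
      using CU(3) card_mono[OF separator_finite[OF separator_boundary[OF CU(1)]] T(1)] by simp
    then have "T = S"
      using max T(2) CT C(2) by blast
    then show ?thesis
      using CT C(2) by blast
  qed
  ultimately show ?thesis
    unfolding maximal_bounded_sets_def by blast
qed

text \<open>Minimality comes from the maximality of \<open>C\<close>: a minimal separator inside the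
  boundary has a \<open>Y\<close>-side containing \<open>C\<close>, hence equal to \<open>C\<close>,
  and so it is the whole boundary.\<close>

lemma leftmost_boundary:
  assumes "C \<in> leftmost_sets k"
  shows "leftmost_separator G X Y k (boundary (nbrs G) Y C)"
proof -
  have C: "C \<subseteq> verts G - X" "accessible (nbrs G) Y {} C" "card (boundary (nbrs G) Y C) \<le> k"
    and max: "\<And>D. \<lbrakk>D \<in> bounded_sets (nbrs G) Y {} (verts G - X) k; C \<subseteq> D\<rbrakk> \<Longrightarrow> D = C"
    using assms unfolding maximal_bounded_sets_def bounded_sets_def by auto
  have eq: "T = boundary (nbrs G) Y C"
    if T: "minimal_separator G X Y T" "card T \<le> k" "C \<subseteq> reach_avoiding G Y T" for T
  proof -
    have T_eq: "T = boundary (nbrs G) Y (reach_avoiding G Y T)"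
      using T(1) by (rule minimal_separator_eq_boundary)
    have "separator G X Y T"
      using T(1) unfolding minimal_separator_def by blast
    then have "reach_avoiding G Y T \<in> bounded_sets (nbrs G) Y {} (verts G - X) k"
      using T(2) T_eq reach_avoiding_subset accessible_reach_avoiding
      unfolding bounded_sets_def by auto
    then show ?thesis
      using max[OF _ T(3)] T_eq by metis
  qed
  have sep: "separator G X Y (boundary (nbrs G) Y C)"
    using C(1) by (rule separator_boundary)
  obtain T where T: "T \<subseteq> boundary (nbrs G) Y C" "minimal_separator G X Y T"
    using minimal_separator_exists[OF sep] by blast
  have "T = boundary (nbrs G) Y C"
  proof (rule eq[OF T(2)])
    show "card T \<le> k"
      using C(3) card_mono[OF separator_finite[OF sep] T(1)] by simp
    show "C \<subseteq> reach_avoiding G Y T"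
      using reach_avoiding_antimono[OF T(1)] reach_avoiding_boundary[OF C(2)] by simp
  qed
  then have "minimal_separator G X Y (boundary (nbrs G) Y C)"
    using T(2) by simp
  then show ?thesis
    unfolding leftmost_separator_iff minimal_separator_le_def reach_avoiding_boundary[OF C(2)]
    by (intro conjI allI impI eq C(3)) simp_all
qed

lemma finite_leftmost: "finite {S. leftmost_separator G X Y k S}"
  by (rule finite_subset[of _ "Pow (verts G)"])
    (auto simp: leftmost_separator_def minimal_separator_le_def
      dest: minimal_separator_subset_verts)

lemma finite_important: "finite {S. important_separator G X Y k S}"
  by (rule finite_subset[of _ "Pow (verts G)"])
    (auto simp: important_separator_def minimal_separator_le_def
      dest: minimal_separator_subset_verts)

lemma minimal_separator_eq_empty:
  "\<lbrakk>separator G X Y {}; minimal_separator G X Y S\<rbrakk> \<Longrightarrow> S = {}"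
  unfolding minimal_separator_def by blast

section \<open>Upper bounds\<close>

lemma card_leftmost_le:
  "real (card {S. leftmost_separator G X Y (Suc n) S}) \<le> catalan n"
proof -
  let ?A = "{S. leftmost_separator G X Y (Suc n) S}"
  have "card ?A \<le> ballot n 1"
  proof (cases "separator G X Y {}")
    case True
    \<comment> \<open>If the empty set separates, it is the only minimal separator. This case is
      split off because the counting lemma asks for \<open>0 < l\<close>.\<close>
    then have "?A \<subseteq> {{}}"
      using minimal_separator_eq_empty
      unfolding leftmost_separator_def minimal_separator_le_def by blast
    then have "card ?A \<le> 1"
      using card_mono[of "{{}}" ?A] by simp
    then show ?thesis
      using ballot_pos[of 1 n] by linarith
  next
    case False
    have lower: "1 \<le> card (boundary (nbrs G) Y C)" if "C \<subseteq> verts G - X" for C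
    proof -
      have sep: "separator G X Y (boundary (nbrs G) Y C)"
        using that by (rule separator_boundary)
      then have "boundary (nbrs G) Y C \<noteq> {}"
        using False by metis
      then show ?thesis
        using separator_finite[OF sep] by (simp add: Suc_le_eq card_gt_0_iff)
    qed
    \<comment> \<open>All boundaries are nonempty, so \<open>Suc n\<close> is split as
      \<open>n + l\<close> with \<open>l = 1\<close>.\<close>
    have "card (leftmost_sets (n + 1)) \<le> ballot n 1"
    proof (rule card_maximal_bounded_sets_le_ballot)
      show "finite Y"
        using Y_verts finite_verts by (rule finite_subset)
    qed (use finite_nbrs lower in simp_all)
    moreover have "inj_on (reach_avoiding G Y) ?A"
    proof (rule inj_onI)
      fix S T assume ST: "S \<in> ?A" "T \<in> ?A" "reach_avoiding G Y S = reach_avoiding G Y T"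
      then have "minimal_separator G X Y S" "minimal_separator G X Y T"
        unfolding leftmost_separator_def minimal_separator_le_def by blast+
      then show "S = T"
        using minimal_separator_eq_boundary ST(3) by metis
    qed
    then have "card ?A \<le> card (leftmost_sets (Suc n))"
    proof (rule card_inj_on_le)
      show "reach_avoiding G Y ` ?A \<subseteq> leftmost_sets (Suc n)"
        using reach_avoiding_leftmost by blast
    qed (simp add: finite_maximal_bounded_sets)
    ultimately show ?thesis by simp
  qed
  then show ?thesis
    unfolding ballot_1_eq_catalan[symmetric] by (rule of_nat_mono)
qed

lemma card_important_le:
  "real (card {S. important_separator G X Y (Suc n) S}) \<le> (\<Sum>i=0..n. catalan i)"
proof -
  let ?A = "{S. important_separator G X Y (Suc n) S}"
  have pos: "0 \<le> catalan i" for i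
    unfolding catalan_def by simp
  show ?thesis
  proof (cases "separator G X Y {}")
    case True
    then have "?A \<subseteq> {{}}"
      using minimal_separator_eq_empty
      unfolding important_separator_def minimal_separator_le_def by blast
    then have "real (card ?A) \<le> 1"
      using card_mono[of "{{}}" ?A] by simp
    also have "\<dots> = catalan 0"
      by (simp add: catalan_def)
    also have "\<dots> \<le> (\<Sum>i=0..n. catalan i)"
      using pos by (intro member_le_sum) auto
    finally show ?thesis .
  next
    case False
    \<comment> \<open>Sort by size, written \<open>Suc i\<close>: size 0 is excluded because the
      empty set does not separate.\<close>
    have "?A \<subseteq> (\<Union>i\<in>{0..n}. {S. leftmost_separator G X Y (Suc i) S})"
    proof
      fix S assume "S \<in> ?A"
      then have S: "leftmost_separator G X Y (card S) S" "card S \<le> Suc n"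
        using important_separator_iff by auto
      then have "separator G X Y S"
        unfolding leftmost_separator_def minimal_separator_le_def minimal_separator_def by blast
      then have "card S \<noteq> 0"
        using False separator_finite by auto
      then show "S \<in> (\<Union>i\<in>{0..n}. {S. leftmost_separator G X Y (Suc i) S})"
        using S by (cases "card S") auto
    qed
    then have "card ?A \<le> card (\<Union>i\<in>{0..n}. {S. leftmost_separator G X Y (Suc i) S})"
      by (intro card_mono finite_UN_I finite_leftmost) auto
    also have "\<dots> \<le> (\<Sum>i=0..n. card {S. leftmost_separator G X Y (Suc i) S})"
      by (intro card_UN_le) simp
    finally have "real (card ?A) \<le> real (\<Sum>i=0..n. card {S. leftmost_separator G X Y (Suc i) S})"
      by (rule of_nat_mono)
    also have "\<dots> \<le> (\<Sum>i=0..n. catalan i)"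
      using card_leftmost_le by (simp add: sum_mono)
    finally show ?thesis .
  qed
qed

end

section \<open>Subtrees of the infinite binary tree\<close>

text \<open>The node \<open>c > 0\<close> has the children \<open>2 * c\<close> and \<open>2 * c + 1\<close>; the root is \<open>1\<close>.\<close>

definition subtree :: "nat set \<Rightarrow> bool" where
  "subtree C \<longleftrightarrow> 0 \<notin> C \<and> (\<forall>c\<in>C. c = 1 \<or> c div 2 \<in> C)"

text \<open>Since \<open>1 div 2 = 0\<close> is in no subtree, the root is added by hand; the empty
  subtree has the frontier \<open>{1}\<close>.\<close>

definition front :: "nat set \<Rightarrow> nat set" where
  "front C = insert 1 {c. c div 2 \<in> C} - C"

text \<open>A subtree with \<open>n\<close> nodes has at most \<open>n\<close> levels, hence the
  bound \<open>2 ^ n\<close>. It makes the family finite and keeps its members off the leaves of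
  deeper trees.\<close>

definition subtrees :: "nat \<Rightarrow> nat set set" where
  "subtrees n = {C. subtree C \<and> C \<subseteq> {1..<2 ^ n} \<and> card C = n}"

lemma finite_subtrees: "finite (subtrees n)"
  unfolding subtrees_def by (rule finite_subset[of _ "Pow {1..<2 ^ n}"]) auto

lemma children_eq: "{c. c div 2 \<in> C} = (\<lambda>c. 2 * c) ` C \<union> (\<lambda>c. 2 * c + 1) ` C" for C :: "nat set"
proof (intro set_eqI iffI)
  fix c :: nat assume "c \<in> {c. c div 2 \<in> C}"
  moreover have "c = 2 * (c div 2) \<or> c = 2 * (c div 2) + 1"
    by presburger
  ultimately show "c \<in> (\<lambda>c. 2 * c) ` C \<union> (\<lambda>c. 2 * c + 1) ` C"
    by blast
qed auto

lemma card_children: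
  fixes C :: "nat set"
  assumes "finite C" "0 \<notin> C"
  shows "card (insert 1 {c. c div 2 \<in> C}) = 2 * card C + 1" "finite {c. c div 2 \<in> C}"
proof -
  have "card {c. c div 2 \<in> C} = card ((\<lambda>c. 2 * c) ` C) + card ((\<lambda>c. 2 * c + 1) ` C)"
    unfolding children_eq using assms(1) by (intro card_Un_disjoint) (auto, presburger)
  also have "\<dots> = 2 * card C"
    by (simp add: card_image inj_on_def)
  finally have "card {c. c div 2 \<in> C} = 2 * card C" .
  moreover show fin: "finite {c. c div 2 \<in> C}"
    unfolding children_eq using assms(1) by simp
  ultimately show "card (insert 1 {c. c div 2 \<in> C}) = 2 * card C + 1"
    using assms(2) by simp
qed

text \<open>Of the \<open>2 * card C + 1\<close> candidates at most \<open>card C\<close> lie in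
  \<open>C\<close>. This covers competitors that are not subtrees; subtrees attain equality because
  all their nodes are candidates.\<close>

lemma card_front_ge:
  assumes "finite C" "0 \<notin> C"
  shows "card C + 1 \<le> card (front C)"
  using diff_card_le_card_Diff[OF assms(1), of "insert 1 {c. c div 2 \<in> C}"] card_children[OF assms]
  unfolding front_def by simp

lemma card_front_subtree:
  assumes "finite C" "subtree C"
  shows "card (front C) = card C + 1"
proof -
  have "C \<subseteq> insert 1 {c. c div 2 \<in> C}" "0 \<notin> C"
    using assms(2) unfolding subtree_def by auto
  then show ?thesis
    using card_Diff_subset[OF assms(1)] card_children[OF assms(1)] unfolding front_def by simp
qed

lemma front_insert:
  assumes "subtree B" "v \<in> front B"
  shows "front (insert v B) = front B - {v} \<union> {2 * v, 2 * v + 1}" "2 * v \<notin> front B"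
    "2 * v + 1 \<notin> front B"
proof -
  have v: "v \<notin> B" "0 < v"
    using assms unfolding front_def subtree_def by (auto intro: gr0I)
  have "c \<notin> B" if "c div 2 = v" for c
    using that assms(1) v unfolding subtree_def by auto
  then have "2 * v \<notin> B" "2 * v + 1 \<notin> B"
    by simp_all
  moreover have "{c. c div 2 \<in> insert v B} = {c. c div 2 \<in> B} \<union> {2 * v, 2 * v + 1}"
    unfolding children_eq by auto
  ultimately show "front (insert v B) = front B - {v} \<union> {2 * v, 2 * v + 1}"
    unfolding front_def using v by auto
  show "2 * v \<notin> front B" "2 * v + 1 \<notin> front B"
    using v unfolding front_def by auto
qed

text \<open>
  Decide one node \<open>v\<close> of the frontier after the other: \<open>W\<close> holds the excluded ones, and including
  \<open>v\<close> puts its two children on the frontier. This is the recursion of \<open>ballot\<close>.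
\<close>

lemma ballot_le_card_subtrees_above:
  assumes "subtree B" "B \<subseteq> {1..<2 ^ card B}" "W \<subseteq> front B" "card (front B - W) = l"
  shows "ballot n l \<le> card {C \<in> subtrees (card B + n). B \<subseteq> C \<and> C \<inter> W = {}}"
  using assms
proof (induction n l arbitrary: B W rule: ballot.induct)
  case (1 l)
  have "B \<in> {C \<in> subtrees (card B + 0). B \<subseteq> C \<and> C \<inter> W = {}}"
    using 1 unfolding subtrees_def front_def by auto
  moreover have "finite {C \<in> subtrees (card B + 0). B \<subseteq> C \<and> C \<inter> W = {}}"
    using finite_subtrees by simp
  ultimately show ?case
    using card_mono[of _ "{B}"] by fastforce
next
  case (2 n)
  then show ?case by simp
next
  case (3 n l)
  note B = 3(3,4) and W = 3(5,6)
  have finB: "finite B"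
    using B(2) finite_subset by blast
  have "front B - W \<noteq> {}"
    using W(2) by (metis card.empty nat.distinct(1))
  then obtain v where v: "v \<in> front B" "v \<notin> W"
    by blast
  have vB: "v \<notin> B" "0 < v"
    using v(1) B(1) unfolding front_def subtree_def by (auto intro: gr0I)
  have cardB: "card (insert v B) = Suc (card B)"
    using finB vB(1) by simp
  let ?S = "\<lambda>B n W. {C \<in> subtrees (card B + n). B \<subseteq> C \<and> C \<inter> W = {}}"
  have finW: "finite (front B - W)"
    by (rule card_ge_0_finite) (simp only: W(2) zero_less_Suc)
  have "front B - insert v W = front B - W - {v}"
    by blast
  then have "card (front B - insert v W) = l"
    using W(2) v finW by simp
  then have IH1: "ballot (Suc n) l \<le> card (?S B (Suc n) (insert v W))"
    using W(1) v(1) by (intro 3(1) B) auto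
  have IH2: "ballot n (l + 2) \<le> card (?S (insert v B) n W)"
  proof (rule 3(2))
    show "subtree (insert v B)"
      using B(1) v(1) vB unfolding subtree_def front_def by auto
    \<comment> \<open>Either \<open>v\<close> is the root or its parent is in \<open>B\<close>, so
      admitting \<open>v\<close> opens at most one new level.\<close>
    have "v = 1 \<or> v div 2 < 2 ^ card B"
      using v(1) B(2) unfolding front_def by auto
    moreover have "(1 :: nat) < 2 ^ Suc (card B)"
      by (rule one_less_power) simp_all
    ultimately have "v < 2 ^ Suc (card B)"
      by auto
    then show "insert v B \<subseteq> {1..<2 ^ card (insert v B)}"
      unfolding cardB using B(2) vB(2) by auto
    show "W \<subseteq> front (insert v B)"
      unfolding front_insert(1)[OF B(1) v(1)] using W(1) v(2) by blast
    have "front (insert v B) - W = front B - W - {v} \<union> {2 * v, 2 * v + 1}"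
      unfolding front_insert(1)[OF B(1) v(1)] using W(1) front_insert(2,3)[OF B(1) v(1)] by blast
    also have "card \<dots> = card (front B - W - {v}) + card {2 * v, 2 * v + 1}"
      using finW front_insert(2,3)[OF B(1) v(1)] by (intro card_Un_disjoint) auto
    also have "\<dots> = l + 2"
      using W(2) v finW by simp
    finally show "card (front (insert v B) - W) = l + 2" .
  qed
  have fin: "finite (?S B' m W')" for B' m W'
    using finite_subtrees by simp
  have "card (?S B (Suc n) (insert v W)) + card (?S (insert v B) n W)
      = card (?S B (Suc n) (insert v W) \<union> ?S (insert v B) n W)"
    by (rule card_Un_disjoint[symmetric, OF fin fin]) blast
  also have "\<dots> \<le> card (?S B (Suc n) W)"
    by (rule card_mono[OF fin]) (auto simp: cardB)
  finally have "card (?S B (Suc n) (insert v W)) + card (?S (insert v B) n W)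
      \<le> card (?S B (Suc n) W)" .
  then show ?case
    using IH1 IH2 by simp
qed

lemma catalan_le_card_subtrees: "catalan n \<le> real (card (subtrees n))"
proof -
  have "front {} = {1}"
    unfolding front_def by simp
  then have "ballot n 1 \<le> card (subtrees n)"
    using ballot_le_card_subtrees_above[of "{}" "{}" 1 n] unfolding subtree_def by simp
  then show ?thesis
    unfolding ballot_1_eq_catalan[symmetric] by (rule of_nat_mono)
qed

section \<open>The complete binary tree\<close>

text \<open>Heap numbering of the tree of depth \<open>k\<close>: level \<open>d\<close> is
  \<open>{2 ^ d..<2 ^ (d + 1)}\<close>, and \<open>{1..<2 ^ k}\<close> are the inner nodes.\<close>

definition binary_tree :: "nat \<Rightarrow> (nat, nat \<times> nat) pre_digraph" where
  "binary_tree k = \<lparr>verts = {1..<2 ^ (k + 1)},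
     arcs = {(u, v). u \<in> {1..<2 ^ (k + 1)} \<and> v \<in> {1..<2 ^ (k + 1)} \<and> (u div 2 = v \<or> v div 2 = u)},
     tail = fst, head = snd\<rparr>"

definition leaves :: "nat \<Rightarrow> nat set" where
  "leaves k = {2 ^ k..<2 ^ (k + 1)}"

lemma graph_binary_tree: "graph (binary_tree k)"
proof unfold_locales
  have "arcs (binary_tree k) \<subseteq> {1..<2 ^ (k + 1)} \<times> {1..<2 ^ (k + 1)}"
    unfolding binary_tree_def by auto
  then show "finite (arcs (binary_tree k))"
    by (rule finite_subset) simp
  show "symmetric (binary_tree k)"
    unfolding symmetric_conv binary_tree_def by auto
qed (auto simp: binary_tree_def arc_to_ends_def)

lemma nbrs_binary_tree:
  "v \<in> nbrs (binary_tree k) u \<longleftrightarrow>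
     u \<in> {1..<2 ^ (k + 1)} \<and> v \<in> {1..<2 ^ (k + 1)} \<and> (u div 2 = v \<or> v div 2 = u)"
  unfolding nbrs_def arcs_ends_conv binary_tree_def by (auto simp: image_iff)

lemma verts_minus_leaves: "verts (binary_tree k) - leaves k = {1..<2 ^ k}"
  unfolding binary_tree_def leaves_def by auto

lemma terminals_binary_tree: "terminals (binary_tree k) (leaves k) {1}"
proof -
  have "(1 :: nat) < 2 ^ (k + 1)"
    by (rule one_less_power) auto
  then show ?thesis
    unfolding terminals_def terminals_axioms_def using graph_binary_tree
    by (auto simp: binary_tree_def leaves_def intro: le_trans[of 1 "2 ^ k"])
qed

text \<open>Inner nodes have both children in the tree. The boundary of a set that is not closed
  under parents may also contain parents, hence only an inclusion.\<close>

lemma front_subset_boundary: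
  assumes "C \<subseteq> {1..<2 ^ k}"
  shows "front C \<subseteq> boundary (nbrs (binary_tree k)) {1} C"
proof
  fix w assume w: "w \<in> front C"
  show "w \<in> boundary (nbrs (binary_tree k)) {1} C"
  proof (cases "w = 1")
    case True
    then show ?thesis
      using w unfolding front_def boundary_def reach_step_def by simp
  next
    case False
    then have u: "w div 2 \<in> C"
      using w unfolding front_def by simp
    then have "w div 2 \<in> {1..<2 ^ k}"
      using assms by blast
    then have "w \<in> nbrs (binary_tree k) (w div 2)"
      unfolding nbrs_binary_tree by auto
    then show ?thesis
      using u w unfolding front_def boundary_def reach_step_def by blast
  qed
qed

lemma boundary_subtree:
  assumes "subtree C" "C \<subseteq> {1..<2 ^ k}"
  shows "boundary (nbrs (binary_tree k)) {1} C = front C"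
proof
  show "boundary (nbrs (binary_tree k)) {1} C \<subseteq> front C"
    using assms(1)
    unfolding boundary_def reach_step_def front_def subtree_def
    by (fastforce simp: nbrs_binary_tree)
qed (rule front_subset_boundary[OF assms(2)])

lemma accessible_subtree:
  assumes "subtree C" "C \<subseteq> {1..<2 ^ k}"
  shows "accessible (nbrs (binary_tree k)) {1} {} C"
proof (rule accessibleI)
  fix D assume D: "reach_step (nbrs (binary_tree k)) {1} D \<inter> C \<subseteq> D"
  have "c \<in> D" if "c \<in> C" for c
    using that
  proof (induction c rule: less_induct)
    case (less c)
    show ?case
    proof (cases "c = 1")
      case True
      then show ?thesis
        using D less.prems unfolding reach_step_def by blast
    next
      case False
      then have "c div 2 \<in> C" "0 < c"
        using assms(1) less.prems unfolding subtree_def by (auto intro: gr0I)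
      moreover from this have "c \<in> nbrs (binary_tree k) (c div 2)"
        using assms(2) less.prems unfolding nbrs_binary_tree by fastforce
      ultimately show ?thesis
        using D less.prems less.IH[of "c div 2"] unfolding reach_step_def by auto
    qed
  qed
  then show "C \<subseteq> D" by blast
qed simp

text \<open>Any set \<open>D\<close> of inner nodes has at least \<open>card D + 1\<close> boundary
  vertices, so the bound \<open>Suc n\<close> leaves no room strictly above
  \<open>C\<close>.\<close>

lemma subtree_leftmost:
  assumes C: "C \<in> subtrees n" and "n < k"
  shows "C \<in> maximal_bounded_sets (nbrs (binary_tree k)) {1} {}
    (verts (binary_tree k) - leaves k) (Suc n)"
    and "accessible (nbrs (binary_tree k)) {1} {} C"
    and "card (boundary (nbrs (binary_tree k)) {1} C) = Suc n"
proof -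
  have "{1..<2 ^ n} \<subseteq> {1..<(2 :: nat) ^ k}"
    using assms(2) by (auto intro: less_le_trans)
  moreover have "subtree C" "C \<subseteq> {1..<2 ^ n}" "card C = n"
    using C unfolding subtrees_def by simp_all
  ultimately have sub: "subtree C" "C \<subseteq> {1..<2 ^ k}" "card C = n"
    by blast+
  show acc: "accessible (nbrs (binary_tree k)) {1} {} C"
    using accessible_subtree[OF sub(1,2)] .
  show card: "card (boundary (nbrs (binary_tree k)) {1} C) = Suc n"
    using boundary_subtree[OF sub(1,2)] card_front_subtree[OF finite_subset[OF sub(2)] sub(1)]
      sub(3) by simp
  have "D = C" if D: "D \<subseteq> {1..<2 ^ k}" "C \<subseteq> D"
    "card (boundary (nbrs (binary_tree k)) {1} D) \<le> Suc n" for D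
  proof -
    have finD: "finite D" "0 \<notin> D"
      using D(1) finite_subset by auto
    have "finite (boundary (nbrs (binary_tree k)) {1} D)"
      using finD(1) graph.finite_nbrs[OF graph_binary_tree] by (intro finite_boundary) auto
    then have "card D + 1 \<le> Suc n"
      using card_front_ge[OF finD] card_mono[OF _ front_subset_boundary[OF D(1)]] D(3)
      by linarith
    then show ?thesis
      using card_seteq[OF finD(1) D(2)] sub(3) by simp
  qed
  then show "C \<in> maximal_bounded_sets (nbrs (binary_tree k)) {1} {}
    (verts (binary_tree k) - leaves k) (Suc n)"
    unfolding maximal_bounded_sets_def bounded_sets_def verts_minus_leaves
    using acc card sub(2) by auto
qed

section \<open>Attaining both bounds\<close>

lemma leftmost_binary_tree_attained:
  "real (card {S. leftmost_separator (binary_tree (Suc n)) (leaves (Suc n)) {1} (Suc n) S})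
    = catalan n"
proof -
  interpret terminals "binary_tree (Suc n)" "leaves (Suc n)" "{1}"
    by (rule terminals_binary_tree)
  let ?bd = "boundary (nbrs (binary_tree (Suc n))) {1}"
  \<comment> \<open>Accessible sets are determined by their boundaries. This yields at least
    \<open>catalan n\<close> leftmost separators, and the upper bound closes the gap.\<close>
  have "inj_on ?bd (subtrees n)"
    using subtree_leftmost(2)[of _ n "Suc n"] by (intro inj_on_subset[OF inj_on_boundary]) auto
  then have "card (subtrees n) \<le>
      card {S. leftmost_separator (binary_tree (Suc n)) (leaves (Suc n)) {1} (Suc n) S}"
    using subtree_leftmost(1) leftmost_boundary finite_leftmost
    by (intro card_inj_on_le[of ?bd]) auto
  then show ?thesis
    using card_leftmost_le[of n] catalan_le_card_subtrees[of n] by linarith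
qed

lemma important_binary_tree_attained:
  "real (card {S. important_separator (binary_tree (Suc n)) (leaves (Suc n)) {1} (Suc n) S})
    = (\<Sum>i=0..n. catalan i)"
proof -
  interpret terminals "binary_tree (Suc n)" "leaves (Suc n)" "{1}"
    by (rule terminals_binary_tree)
  let ?bd = "boundary (nbrs (binary_tree (Suc n))) {1}" and ?T = "\<Union>i\<in>{0..n}. subtrees i"
  let ?A = "{S. important_separator (binary_tree (Suc n)) (leaves (Suc n)) {1} (Suc n) S}"
  have "inj_on ?bd ?T"
    using subtree_leftmost(2)[of _ _ "Suc n"] by (intro inj_on_subset[OF inj_on_boundary]) auto
  moreover have "?bd ` ?T \<subseteq> ?A"
  proof clarify
    fix i C assume i: "i \<in> {0..n}" and C: "C \<in> subtrees i"
    \<comment> \<open>One tree serves all sizes, as its depth exceeds every \<open>i\<close>. A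
      subtree with \<open>i\<close> nodes has a boundary of size \<open>Suc i\<close>, leftmost for
      exactly that bound.\<close>
    have "i < Suc n"
      using i by simp
    note left = subtree_leftmost[OF C this]
    show "important_separator (binary_tree (Suc n)) (leaves (Suc n)) {1} (Suc n) (?bd C)"
      unfolding important_separator_iff left(3) using leftmost_boundary[OF left(1)] i by simp
  qed
  ultimately have "card ?T \<le> card ?A"
    using finite_important by (intro card_inj_on_le)
  moreover have "card ?T = (\<Sum>i=0..n. card (subtrees i))"
    using finite_subtrees by (intro card_UN_disjoint) (auto simp: subtrees_def)
  moreover have "(\<Sum>i=0..n. catalan i) \<le> (\<Sum>i=0..n. real (card (subtrees i)))"
    by (intro sum_mono catalan_le_card_subtrees)
  ultimately have "(\<Sum>i=0..n. catalan i) \<le> real (card ?A)"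
    by (simp add: of_nat_sum[symmetric] del: of_nat_sum)
  then show ?thesis
    using card_important_le[of n] by linarith
qed

theorem theorem6:
  fixes k :: nat
  assumes "k \<ge> 1"
  shows
    "(\<forall>(G :: ('a, 'b) pre_digraph) X Y. graph G \<and> X \<subseteq> verts G \<and> Y \<subseteq> verts G \<longrightarrow>
        real (card {S. leftmost_separator G X Y k S}) \<le> catalan (k - 1) \<and>
        real (card {S. important_separator G X Y k S}) \<le> (\<Sum>i=0..k-1. catalan i)) \<and>
     (\<exists>(G :: (nat, nat \<times> nat) pre_digraph) X Y. graph G \<and> X \<subseteq> verts G \<and> Y \<subseteq> verts G \<and>
        real (card {S. leftmost_separator G X Y k S}) = catalan (k - 1)) \<and>
     (\<exists>(G :: (nat, nat \<times> nat) pre_digraph) X Y. graph G \<and> X \<subseteq> verts G \<and> Y \<subseteq> verts G \<and>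
        real (card {S. important_separator G X Y k S}) = (\<Sum>i=0..k-1. catalan i))"
proof -
  obtain n where k: "k = Suc n"
    using assms by (cases k) auto
  have tree: "graph (binary_tree k)" "leaves k \<subseteq> verts (binary_tree k)"
    "{1} \<subseteq> verts (binary_tree k)"
    using terminals_binary_tree[of k] graph_binary_tree
    unfolding terminals_def terminals_axioms_def by auto
  have XY: "terminals G X Y" if "graph G \<and> X \<subseteq> verts G \<and> Y \<subseteq> verts G"
    for G :: "('a, 'b) pre_digraph" and X Y
    using that unfolding terminals_def terminals_axioms_def by blast
  show ?thesis
  proof (intro conjI allI impI)
    fix G :: "('a, 'b) pre_digraph" and X Y
    assume "graph G \<and> X \<subseteq> verts G \<and> Y \<subseteq> verts G"
    note terminals = XY[OF this]
    show "real (card {S. leftmost_separator G X Y k S}) \<le> catalan (k - 1)"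
      using terminals.card_leftmost_le[OF terminals, of n] k by simp
    show "real (card {S. important_separator G X Y k S}) \<le> (\<Sum>i=0..k-1. catalan i)"
      using terminals.card_important_le[OF terminals, of n] k by simp
  next
    show "\<exists>(G :: (nat, nat \<times> nat) pre_digraph) X Y. graph G \<and> X \<subseteq> verts G \<and> Y \<subseteq> verts G \<and>
        real (card {S. leftmost_separator G X Y k S}) = catalan (k - 1)"
      using leftmost_binary_tree_attained[of n] k
      by (intro exI[of _ "binary_tree k"] exI[of _ "leaves k"] exI[of _ "{1}"] conjI tree) simp
    show "\<exists>(G :: (nat, nat \<times> nat) pre_digraph) X Y. graph G \<and> X \<subseteq> verts G \<and> Y \<subseteq> verts G \<and>
        real (card {S. important_separator G X Y k S}) = (\<Sum>i=0..k-1. catalan i)"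
      using important_binary_tree_attained[of n] k
      by (intro exI[of _ "binary_tree k"] exI[of _ "leaves k"] exI[of _ "{1}"] conjI tree) simp
  qed
qed

end
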